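(* Let $n\ge2$, $1\le r\le n-1$, $\alpha,\beta,\gamma\in\mathbb{Z}_2^{n-r}$, $\alpha',\beta',\gamma'\in\mathbb{Z}_2^{r}$, $\omega=\omega(\alpha,\beta,\gamma)$ and $\omega'=\omega(\alpha',\beta',\gamma')$. Then $\mathrm{adp}^{\mathrm{XR}}_r(\alpha'\|\alpha,\ \beta'\|\beta\to\gamma\|\gamma')=0$ if and only if for some $X\in\{1,\dots,7\}$ the word $\omega'$ satisfies the pattern $M_X$ and $\omega$ satisfies at least one pattern in the list $P_X$, where: $M_1=$ [.*d00*], $P_1$: [$\alpha_0$*], [$\beta_0$*], [0$\hat0$*], [0$\hat0$*1.*], [0$\hat0$*2$\alpha_0$*], [0$\hat0$*4$\beta_0$*], [0$\hat0$*7], [0$\hat0$*7$\gamma_1$*$1_7$], [1$\hat1$*], [1$\hat1$*0.*], [1$\hat1$*3$\alpha_0$*], [1$\hat1$*5$\beta_0$*], [1$\hat1$*6], [1$\hat1$*6$\gamma_0$*$0_6$]; $M_2=$ [.*e22*], $P_2$: [$\alpha_0$*], [2$\hat2$*], [2$\hat2$*3.*], [2$\hat2$*0$\alpha_0$*], [2$\hat2$*5$\gamma_1$*$1_7$], [3$\hat3$*], [3$\hat3$*2.*], [3$\hat3$*1$\alpha_0$*], [3$\hat3$*4$\gamma_0$*$0_6$]; $M_3=$ [.*e44*], $P_3$: [$\beta_0$*], [4$\hat4$*], [4$\hat4$*5.*], [4$\hat4$*0$\beta_0$*], [4$\hat4$*3$\gamma_1$*$1_7$], [5$\hat5$*], [5$\hat5$*4.*],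 [5$\hat5$*1$\beta_0$*], [5$\hat5$*2$\gamma_0$*$0_6$]; $M_4=$ [.*d66*], $P_4$: [6$\hat6$*7.*], [6$\hat6$*1$\gamma_1$*$1_7$], [7$\hat7$*6.*], [7$\hat7$*0$\gamma_0$*$0_6$]; $M_5=$ [.*d], $P_5$: [0*], [1*]; $M_6=$ [.*], $P_6$: [.*d00*], [.*e11*]; $M_7=$ [$\gamma_0$*], $P_7$: [.*d].
   Context: For $x\in\mathbb{Z}_2^m$ write $x=(x_0,\dots,x_{m-1})$, identified with the integer $\sum_i x_i2^{m-1-i}$ ($x_0$ most significant); arithmetic on $\mathbb{Z}_2^n$ is modulo $2^n$. $\oplus$ is bitwise XOR, $x\lll r=(x_r,\dots,x_{n-1},x_0,\dots,x_{r-1})$, and $\alpha\|\beta=(\alpha_0,\dots,\alpha_{m-1},\beta_0,\dots,\beta_{k-1})$ is concatenation. For $f:(\mathbb{Z}_2^n)^2\to\mathbb{Z}_2^n$, $\mathrm{adp}^f(\alpha,\beta\to\gamma)=4^{-n}\#\{(x,y): f(x+\alpha,y+\beta)=f(x,y)+\gamma\}$; $\mathrm{adp}^{\mathrm{XR}}_r$ is this for $f(x,y)=(x\oplus y)\lll r$. For $\alpha,\beta,\gamma\in\mathbb{Z}_2^m$ the octal word $\omega(\alpha,\beta,\gamma)\in\{0,\dots,7\}^m$ has symbols $\omega_i=4\alpha_i+2\beta_i+\gamma_i$; symbols are also viewed as elements of $\mathbb{Z}_2^3$ so $\oplus$ applies to them. Patterns: a pattern is written between [ (most significant end) and ] (least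 significant end), and a word satisfies it if the whole word, read from $\omega_0$ to $\omega_{m-1}$, matches it in the sense of regular expressions, where each pattern symbol matches one octal symbol as follows: a digit $t$ matches exactly $t$; '.' matches any symbol; e matches $0,3,5,6$; d matches $1,2,4,7$; $\hat t$ matches $t, t\oplus3, t\oplus5$; $\alpha_0$ matches $0,1,2,3$; $\alpha_1$ matches $4,5,6,7$; $\beta_0$ matches $0,1,4,5$; $\beta_1$ matches $2,3,6,7$; $\gamma_0$ matches $0,2,4,6$; $\gamma_1$ matches $1,3,5,7$; $0_6$ matches $0,6$; $1_7$ matches $1,7$; and s* (for a pattern symbol s) matches zero or more consecutive symbols each matched by s. *)

theory Defs
  imports Complex_Main
begin

text \<open>An element of Z_2^m is a bool list of length m; the head is x_0, the most
significant bit.  Its integer value:\<close>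
definition bval :: "bool list \<Rightarrow> nat" where
  "bval xs = foldl (\<lambda>acc b. 2 * acc + (if b then 1 else 0)) 0 xs"

text \<open>Left rotation by r of an n-bit number: (x_r,...,x_{n-1},x_0,...,x_{r-1}).\<close>
definition rotl :: "nat \<Rightarrow> nat \<Rightarrow> nat \<Rightarrow> nat" where
  "rotl n r x = (x * 2 ^ r) mod 2 ^ n + x div 2 ^ (n - r)"

definition adp :: "nat \<Rightarrow> (nat \<Rightarrow> nat \<Rightarrow> nat) \<Rightarrow> nat \<Rightarrow> nat \<Rightarrow> nat \<Rightarrow> real" where
  "adp n f a b g =
     real (card {(x, y). x < 2 ^ n \<and> y < 2 ^ n \<and>
        f ((x + a) mod 2 ^ n) ((y + b) mod 2 ^ n) = (f x y + g) mod 2 ^ n}) / 4 ^ n"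

definition adpXR :: "nat \<Rightarrow> nat \<Rightarrow> nat \<Rightarrow> nat \<Rightarrow> nat \<Rightarrow> real" where
  "adpXR n r a b g = adp n (\<lambda>x y. rotl n r (xor x y)) a b g"

definition omega :: "bool list \<Rightarrow> bool list \<Rightarrow> bool list \<Rightarrow> nat list" where
  "omega a b c = map (\<lambda>(x, y, z). 4 * (if x then 1 else 0) + 2 * (if y then 1 else 0)
                                   + (if z then 1 else 0)) (zip a (zip b c))"

datatype item = One "nat set" | Star "nat set"

type_synonym pat = "item list"

fun matches :: "pat \<Rightarrow> nat list \<Rightarrow> bool" where
  "matches [] w = (w = [])"
| "matches (One S # p) w = (case w of [] \<Rightarrow> False | c # w' \<Rightarrow> c \<in> S \<and> matches p w')"
| "matches (Star S # p) w =
     (\<exists>k \<le> length w. (\<forall>c \<in> set (take k w). c \<in> S) \<and> matches p (drop k w))"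

definition cDot :: "nat set" where "cDot = {0, 1, 2, 3, 4, 5, 6, 7}"
definition cE :: "nat set" where "cE = {0, 3, 5, 6}"
definition cD :: "nat set" where "cD = {1, 2, 4, 7}"
definition cHat :: "nat \<Rightarrow> nat set" where "cHat t = {t, xor t 3, xor t 5}"
definition cA0 :: "nat set" where "cA0 = {0, 1, 2, 3}"
definition cA1 :: "nat set" where "cA1 = {4, 5, 6, 7}"
definition cB0 :: "nat set" where "cB0 = {0, 1, 4, 5}"
definition cB1 :: "nat set" where "cB1 = {2, 3, 6, 7}"
definition cG0 :: "nat set" where "cG0 = {0, 2, 4, 6}"
definition cG1 :: "nat set" where "cG1 = {1, 3, 5, 7}"
definition c06 :: "nat set" where "c06 = {0, 6}"
definition c17 :: "nat set" where "c17 = {1, 7}"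

abbreviation dg :: "nat \<Rightarrow> item" where "dg t \<equiv> One {t}"

definition pattern_table :: "(pat \<times> pat list) list" where
  "pattern_table = [
   ( [Star cDot, One cD, dg 0, Star {0}],
     [ [Star cA0], [Star cB0], [dg 0, Star (cHat 0)],
       [dg 0, Star (cHat 0), dg 1, Star cDot],
       [dg 0, Star (cHat 0), dg 2, Star cA0],
       [dg 0, Star (cHat 0), dg 4, Star cB0],
       [dg 0, Star (cHat 0), dg 7],
       [dg 0, Star (cHat 0), dg 7, Star cG1, One c17],
       [dg 1, Star (cHat 1)],
       [dg 1, Star (cHat 1), dg 0, Star cDot],
       [dg 1, Star (cHat 1), dg 3, Star cA0],
       [dg 1, Star (cHat 1), dg 5, Star cB0],
       [dg 1, Star (cHat 1), dg 6],
       [dg 1, Star (cHat 1), dg 6, Star cG0, One c06] ]),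
   ( [Star cDot, One cE, dg 2, Star {2}],
     [ [Star cA0], [dg 2, Star (cHat 2)],
       [dg 2, Star (cHat 2), dg 3, Star cDot],
       [dg 2, Star (cHat 2), dg 0, Star cA0],
       [dg 2, Star (cHat 2), dg 5, Star cG1, One c17],
       [dg 3, Star (cHat 3)],
       [dg 3, Star (cHat 3), dg 2, Star cDot],
       [dg 3, Star (cHat 3), dg 1, Star cA0],
       [dg 3, Star (cHat 3), dg 4, Star cG0, One c06] ]),
   ( [Star cDot, One cE, dg 4, Star {4}],
     [ [Star cB0], [dg 4, Star (cHat 4)],
       [dg 4, Star (cHat 4), dg 5, Star cDot],
       [dg 4, Star (cHat 4), dg 0, Star cB0],
       [dg 4, Star (cHat 4), dg 3, Star cG1, One c17],
       [dg 5, Star (cHat 5)],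
       [dg 5, Star (cHat 5), dg 4, Star cDot],
       [dg 5, Star (cHat 5), dg 1, Star cB0],
       [dg 5, Star (cHat 5), dg 2, Star cG0, One c06] ]),
   ( [Star cDot, One cD, dg 6, Star {6}],
     [ [dg 6, Star (cHat 6), dg 7, Star cDot],
       [dg 6, Star (cHat 6), dg 1, Star cG1, One c17],
       [dg 7, Star (cHat 7), dg 6, Star cDot],
       [dg 7, Star (cHat 7), dg 0, Star cG0, One c06] ]),
   ( [Star cDot, One cD],
     [ [Star {0}], [Star {1}] ]),
   ( [Star cDot],
     [ [Star cDot, One cD, dg 0, Star {0}],
       [Star cDot, One cE, dg 1, Star {1}] ]),
   ( [Star cG0],
     [ [Star cDot, One cD] ])
  ]"

definition M :: "nat \<Rightarrow> pat" where "M X = fst (pattern_table ! (X - 1))"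
definition P :: "nat \<Rightarrow> pat list" where "P X = snd (pattern_table ! (X - 1))"

end

theory Submission
  imports Defs
begin

text \<open>
  Splitting every number into its high \<open>r\<close> and low \<open>n - r\<close> bits, the equation defining the
  differential probability decouples into one system for each half, linked by three carry bits: the
  carries \<open>c\<^sub>1\<close>, \<open>c\<^sub>2\<close> of the two additions to \<open>x\<close> and \<open>y\<close> leave the low half and enter the high half,
  while the rotation sends the carry \<open>c\<^sub>3\<close> of the output addition from the high half to the low half.
  Reading an octal word from its least significant symbol, a half is a nondeterministic automaton on
  the eight carry states \<open>(c\<^sub>1, c\<^sub>2, c\<^sub>3)\<close>.  Let \<open>H\<close> be the set of triples that the high half
  realises and \<open>L\<close> the one of the low half; the probability vanishes iff \<open>H\<close> and \<open>L\<close> are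
  disjoint.

  There are seven sets \<open>A\<^sub>X\<close> of carry triples such that \<open>\<omega>'\<close> satisfies \<open>M\<^sub>X\<close> iff
  \<open>H \<subseteq> A\<^sub>X\<close>, and \<open>\<omega>\<close> satisfies a pattern of \<open>P\<^sub>X\<close> or \<open>P\<^sub>6\<close> iff
  \<open>L \<inter> A\<^sub>X = {}\<close> (\<open>P\<^sub>6\<close> says that \<open>L\<close> is empty).  Each of these is an equivalence between a
  finite automaton and a list of regular expressions; it is decided by running the backward
  determinisation of the automaton and the derivatives of the patterns in lockstep.  It remains that
  disjointness of \<open>H\<close> and \<open>L\<close> is always witnessed by some \<open>A\<^sub>X\<close>, which follows
  from a few facts on the shapes of \<open>H\<close> and \<open>L\<close>.
\<close>

section \<open>The carry automaton\<close>

type_synonym bits = "bool \<times> bool \<times> bool"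

fun enc :: "bits \<Rightarrow> nat" where
  "enc (x, y, z) = 4 * (if x then 1 else 0) + 2 * (if y then 1 else 0) + (if z then 1 else 0)"

lemma omega_eq_map_enc: "omega a b c = map enc (zip a (zip b c))"
proof -
  have "(\<lambda>(x, y, z). 4 * (if x then 1 else 0) + 2 * (if y then 1 else 0) + (if z then 1 else 0)) = enc"
    by (auto simp: fun_eq_iff)
  then show ?thesis by (simp only: omega_def)
qed

fun parity :: "bits \<Rightarrow> bool" where
  "parity (x, y, z) = (x \<noteq> (y \<noteq> z))"

definition maj :: "bool \<Rightarrow> bool \<Rightarrow> bool \<Rightarrow> bool" where
  "maj x y z = (if x then y \<or> z else y \<and> z)"

text \<open>Carry states reachable after one bit position with difference bits \<open>(a, b, g)\<close>, over all choices
  of the bits \<open>x\<close>, \<open>y\<close>; the output bit is correct iff the six bits have even parity, whatever \<open>x\<close>, \<open>y\<close> are.\<close>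

fun succs :: "bits \<Rightarrow> bits \<Rightarrow> bits list" where
  "succs (a, b, g) (p, q, r) =
     (if parity (a, b, g) = parity (p, q, r)
      then map (\<lambda>(x, y). (maj x a p, maj y b q, maj (x \<noteq> y) g r))
             [(False, False), (False, True), (True, False), (True, True)]
      else [])"

text \<open>The head is the most significant symbol, so the tail runs first: \<open>s\<close> enters
  at the least significant end.\<close>

fun reach :: "bits list \<Rightarrow> bits \<Rightarrow> bits set" where
  "reach [] s = {s}"
| "reach (t # w) s = (\<Union>s' \<in> reach w s. set (succs t s'))"

section \<open>Carries of the split additions\<close>

lemma foldl_bval:
  "foldl (\<lambda>acc b. 2 * acc + (if b then 1 else 0)) k xs = k * 2 ^ length xs + bval xs"
proof (induction xs arbitrary: k)
  case (Cons x xs)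
  have "bval (x # xs) = foldl (\<lambda>acc b. 2 * acc + (if b then 1 else 0)) (if x then 1 else 0) xs"
    by (simp add: bval_def)
  with Cons[of "if x then 1 else 0"] Cons[of "2 * k + (if x then 1 else 0)"] show ?case
    by (simp add: algebra_simps)
qed (simp add: bval_def)

lemma bval_Nil: "bval [] = 0"
  by (simp add: bval_def)

lemma bval_Cons: "bval (x # xs) = of_bool x * 2 ^ length xs + bval xs"
  using foldl_bval[of "of_bool x" xs] by (simp add: bval_def of_bool_def)

lemma bval_append: "bval (xs @ ys) = bval xs * 2 ^ length ys + bval ys"
  by (induction xs) (simp_all add: bval_Nil bval_Cons power_add algebra_simps)

lemma bval_less: "bval xs < 2 ^ length xs"
proof (induction xs)
  case (Cons x xs)
  then show ?case by (cases x) (simp_all add: bval_Cons)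
qed (simp add: bval_Nil)

lemma xor_less_power2:
  fixes x y :: nat
  assumes "x < 2 ^ m" "y < 2 ^ m"
  shows "xor x y < 2 ^ m"
proof -
  have "take_bit m (xor x y) = xor x y"
    using assms by (simp add: take_bit_xor take_bit_nat_eq_self)
  then show ?thesis by (simp only: take_bit_nat_eq_self_iff)
qed

lemma xor_split:
  fixes x0 x1 y0 y1 :: nat
  assumes "x0 < 2 ^ m" "y0 < 2 ^ m"
  shows "xor (x1 * 2 ^ m + x0) (y1 * 2 ^ m + y0) = xor x1 y1 * 2 ^ m + xor x0 y0"
proof -
  let ?x = "x1 * 2 ^ m + x0" and ?y = "y1 * 2 ^ m + y0"
  have "take_bit m ?x = x0" "take_bit m ?y = y0" "drop_bit m ?x = x1" "drop_bit m ?y = y1"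
    using assms by (simp_all add: take_bit_eq_mod drop_bit_eq_div)
  then have "take_bit m (xor ?x ?y) = xor x0 y0" "drop_bit m (xor ?x ?y) = xor x1 y1"
    by (simp_all only: take_bit_xor drop_bit_xor)
  then show ?thesis
    by (metis bits_ident push_bit_eq_mult)
qed

lemma ex_less_split:
  fixes k m :: nat and Q :: "nat \<Rightarrow> bool"
  shows "(\<exists>x<2 ^ (k + m). Q x) \<longleftrightarrow> (\<exists>x1<2 ^ k. \<exists>x0<2 ^ m. Q (x1 * 2 ^ m + x0))"
proof
  assume "\<exists>x<2 ^ (k + m). Q x"
  then obtain x :: nat where x: "x < 2 ^ (k + m)" "Q x" by blast
  have "x div 2 ^ m < 2 ^ k" using x(1) by (simp add: less_mult_imp_div_less power_add)
  moreover have "x mod 2 ^ m < 2 ^ m" by simp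
  moreover have "Q (x div 2 ^ m * 2 ^ m + x mod 2 ^ m)" unfolding div_mult_mod_eq by (rule x(2))
  ultimately show "\<exists>x1<2 ^ k. \<exists>x0<2 ^ m. Q (x1 * 2 ^ m + x0)" by blast
next
  assume "\<exists>x1<2 ^ k. \<exists>x0<2 ^ m. Q (x1 * 2 ^ m + x0)"
  then obtain x1 x0 :: nat where x: "x1 < 2 ^ k" "x0 < 2 ^ m" "Q (x1 * 2 ^ m + x0)" by blast
  have "x1 * 2 ^ m + x0 < (x1 + 1) * 2 ^ m" using x(2) by simp
  also have "\<dots> \<le> 2 ^ k * 2 ^ m" using x(1) by (intro mult_right_mono) auto
  finally show "\<exists>x<2 ^ (k + m). Q x" using x(3) by (auto simp: power_add)
qed

lemma quot_rem_eq_iff: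
  fixes M :: nat
  assumes "f < M" "f' < M"
  shows "e * M + f = e' * M + f' \<longleftrightarrow> e = e' \<and> f = f'"
proof
  assume "e * M + f = e' * M + f'"
  then have "(e * M + f) div M = (e' * M + f') div M" "(e * M + f) mod M = (e' * M + f') mod M"
    by simp_all
  then show "e = e' \<and> f = f'" using assms by simp
qed simp

text \<open>The low digits plus the incoming carry stay below \<open>2 * M\<close>, so the
  intermediate carry is one bit; uniqueness of quotient and remainder does the rest.\<close>

lemma add_carry_split:
  fixes M K :: nat
  assumes "x0 < M" "a0 < M" "u0 < M"
  shows "x1 * M + x0 + (a1 * M + a0) + of_bool p = u1 * M + u0 + K * M * of_bool p' \<longleftrightarrow>
    (\<exists>c. x0 + a0 + of_bool p = u0 + M * of_bool c \<and> x1 + a1 + of_bool c = u1 + K * of_bool p')"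
    (is "?l \<longleftrightarrow> ?r")
proof
  assume ?r
  then obtain c where c: "x0 + a0 + of_bool p = u0 + M * of_bool c"
    "x1 + a1 + of_bool c = u1 + K * of_bool p'" by blast
  have "x1 * M + x0 + (a1 * M + a0) + of_bool p = (x1 + a1) * M + (x0 + a0 + of_bool p)"
    by (simp add: algebra_simps)
  also have "\<dots> = (x1 + a1 + of_bool c) * M + u0" unfolding c(1) by (simp add: algebra_simps)
  also have "\<dots> = u1 * M + u0 + K * M * of_bool p'" unfolding c(2) by (simp add: algebra_simps)
  finally show ?l .
next
  assume l: ?l
  define c where "c \<longleftrightarrow> M \<le> x0 + a0 + of_bool p"
  define f where "f = x0 + a0 + of_bool p - M * of_bool c"
  have f: "x0 + a0 + of_bool p = f + M * of_bool c" and "f < M"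
    using assms by (auto simp: f_def c_def of_bool_def split: if_splits)
  have "(x1 + a1 + of_bool c) * M + f = (x1 + a1) * M + (x0 + a0 + of_bool p)"
    unfolding f by (simp add: algebra_simps)
  also have "\<dots> = (u1 + K * of_bool p') * M + u0"
    using l by (simp add: algebra_simps)
  finally show ?r using f quot_rem_eq_iff[OF \<open>f < M\<close> \<open>u0 < M\<close>] by metis
qed

lemma mod_eq_iff_carry:
  fixes N :: nat
  assumes "x < N" "a < N" "u < N"
  shows "(x + a) mod N = u \<longleftrightarrow> (\<exists>c. x + a = u + N * of_bool c)"
proof
  assume *: "(x + a) mod N = u"
  show "\<exists>c. x + a = u + N * of_bool c"
  proof (cases "x + a < N")
    case True
    then show ?thesis using * by (intro exI[of _ False]) simp
  next
    case False
    then have "(x + a) mod N = x + a - N" using assms by (simp add: le_mod_geq)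
    then show ?thesis using * False by (intro exI[of _ True]) simp
  qed
next
  assume "\<exists>c. x + a = u + N * of_bool c"
  then show "(x + a) mod N = u" using assms by auto
qed

text \<open>Explicit carries replace \<open>mod\<close>, so that the system can be cut at any bit
  position. \<open>u\<close> and \<open>v\<close> are the inputs after the differences are
  added.\<close>

definition add_xor :: "nat \<Rightarrow> nat \<Rightarrow> nat \<Rightarrow> nat \<Rightarrow> bits \<Rightarrow> bits \<Rightarrow> nat \<Rightarrow> nat \<Rightarrow> nat \<Rightarrow> nat \<Rightarrow> bool" where
  "add_xor m a b g = (\<lambda>(p, q, r) (p', q', r') x y u v.
     x + a + of_bool p = u + 2 ^ m * of_bool p' \<and>
     y + b + of_bool q = v + 2 ^ m * of_bool q' \<and>
     xor x y + g + of_bool r = xor u v + 2 ^ m * of_bool r')"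

definition carries :: "nat \<Rightarrow> nat \<Rightarrow> nat \<Rightarrow> nat \<Rightarrow> bits \<Rightarrow> bits \<Rightarrow> bool" where
  "carries m a b g s s' \<longleftrightarrow>
     (\<exists>x<2 ^ m. \<exists>y<2 ^ m. \<exists>u<2 ^ m. \<exists>v<2 ^ m. add_xor m a b g s s' x y u v)"

lemma ex_conj_distrib3:
  "(\<exists>p q r. (A p \<and> B q \<and> C r) \<and> A' p \<and> B' q \<and> C' r) \<longleftrightarrow>
    (\<exists>p. A p \<and> A' p) \<and> (\<exists>q. B q \<and> B' q) \<and> (\<exists>r. C r \<and> C' r)"
  by blast

text \<open>The linking made by the rotation: \<open>p\<close> and \<open>q\<close> pass from the
  first half to the second, while \<open>r\<close> passes back.\<close>

lemma ex_conj_distrib6: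
  "(\<exists>p q r p' q' r'. (A p \<and> B q \<and> C r r') \<and> A' p p' \<and> B' q q' \<and> C' r) \<longleftrightarrow>
    (\<exists>p' p. A p \<and> A' p p') \<and> (\<exists>q' q. B q \<and> B' q q') \<and> (\<exists>r' r. C' r \<and> C r r')"
  by blast

lemma ex_bound_distrib:
  fixes M K :: nat and Q R :: "'s \<Rightarrow> nat \<Rightarrow> nat \<Rightarrow> nat \<Rightarrow> nat \<Rightarrow> bool"
  shows "(\<exists>x1<K. \<exists>x0<M. \<exists>y1<K. \<exists>y0<M. \<exists>u1<K. \<exists>u0<M. \<exists>v1<K. \<exists>v0<M.
      \<exists>s. Q s x0 y0 u0 v0 \<and> R s x1 y1 u1 v1) \<longleftrightarrow>
    (\<exists>s. (\<exists>x<M. \<exists>y<M. \<exists>u<M. \<exists>v<M. Q s x y u v) \<and> (\<exists>x<K. \<exists>y<K. \<exists>u<K. \<exists>v<K. R s x y u v))"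
proof -
  have "(\<exists>x<N. \<exists>s. S x s) \<longleftrightarrow> (\<exists>s. \<exists>x<N. S x s)" for N :: nat and S :: "nat \<Rightarrow> 's \<Rightarrow> bool"
    by blast
  moreover have "(\<exists>x<N. S x \<and> c) \<longleftrightarrow> (\<exists>x<N. S x) \<and> c" "(\<exists>x<N. c \<and> S x) \<longleftrightarrow> c \<and> (\<exists>x<N. S x)"
    for N :: nat and S c
    by blast+
  ultimately show ?thesis by (simp only:)
qed

lemma add_xor_split:
  assumes "a0 < 2 ^ m" "b0 < 2 ^ m" "g0 < 2 ^ m"
    and "x0 < 2 ^ m" "y0 < 2 ^ m" "u0 < 2 ^ m" "v0 < 2 ^ m"
  shows "add_xor (k + m) (a1 * 2 ^ m + a0) (b1 * 2 ^ m + b0) (g1 * 2 ^ m + g0) s s'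
      (x1 * 2 ^ m + x0) (y1 * 2 ^ m + y0) (u1 * 2 ^ m + u0) (v1 * 2 ^ m + v0) \<longleftrightarrow>
    (\<exists>s''. add_xor m a0 b0 g0 s s'' x0 y0 u0 v0 \<and> add_xor k a1 b1 g1 s'' s' x1 y1 u1 v1)"
proof -
  obtain p q r p' q' r' where s: "s = (p, q, r)" "s' = (p', q', r')" by (cases s; cases s')
  have "xor x0 y0 < 2 ^ m" "xor u0 v0 < 2 ^ m" using assms by (simp_all add: xor_less_power2)
  then show ?thesis
    unfolding add_xor_def s prod.case split_paired_Ex power_add ex_conj_distrib3
    by (simp only: assms xor_split add_carry_split)
qed

lemma carries_compose:
  assumes "a0 < 2 ^ m" "b0 < 2 ^ m" "g0 < 2 ^ m"
  shows "carries (k + m) (a1 * 2 ^ m + a0) (b1 * 2 ^ m + b0) (g1 * 2 ^ m + g0) s s' \<longleftrightarrow>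
    (\<exists>s''. carries m a0 b0 g0 s s'' \<and> carries k a1 b1 g1 s'' s')"
proof -
  have "carries (k + m) (a1 * 2 ^ m + a0) (b1 * 2 ^ m + b0) (g1 * 2 ^ m + g0) s s' \<longleftrightarrow>
    (\<exists>x1<2 ^ k. \<exists>x0<2 ^ m. \<exists>y1<2 ^ k. \<exists>y0<2 ^ m. \<exists>u1<2 ^ k. \<exists>u0<2 ^ m. \<exists>v1<2 ^ k. \<exists>v0<2 ^ m.
      \<exists>s''. add_xor m a0 b0 g0 s s'' x0 y0 u0 v0 \<and> add_xor k a1 b1 g1 s'' s' x1 y1 u1 v1)"
    unfolding carries_def ex_less_split
    by (intro ex_cong1 conj_cong refl add_xor_split assms)
  then show ?thesis unfolding carries_def ex_bound_distrib .
qed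

lemma carries_0: "carries 0 0 0 0 s s' \<longleftrightarrow> s' = s"
  by (cases s; cases s') (auto simp: carries_def add_xor_def)

lemma carries_1: "carries 1 (of_bool x) (of_bool y) (of_bool z) s s' \<longleftrightarrow> s' \<in> set (succs (x, y, z) s)"
proof -
  have ex: "(\<exists>x<2 ^ 1. Q x) \<longleftrightarrow> Q 0 \<or> Q 1" for Q :: "nat \<Rightarrow> bool"
    by (auto simp: less_2_cases_iff)
  obtain p q r p' q' r' where s: "s = (p, q, r)" "s' = (p', q', r')" by (cases s; cases s')
  show ?thesis
    unfolding carries_def ex add_xor_def s prod.case
    by (cases x; cases y; cases z; cases p; cases q; cases r; cases p'; cases q'; cases r')
       (simp_all add: maj_def)
qed

lemma reach_iff_carries:
  assumes "length a = length g" "length b = length g"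
  shows "s' \<in> reach (zip a (zip b g)) s \<longleftrightarrow> carries (length g) (bval a) (bval b) (bval g) s s'"
  using assms
proof (induction g arbitrary: a b s')
  case Nil
  then show ?case by (simp add: carries_0 bval_Nil)
next
  case (Cons z g)
  then obtain x a' y b' where ab: "a = x # a'" "b = y # b'"
    by (metis length_Suc_conv)
  have "bval a' < 2 ^ length g" "bval b' < 2 ^ length g" "bval g < 2 ^ length g"
    using bval_less[of a'] bval_less[of b'] bval_less[of g] Cons.prems by (simp_all add: ab)
  note compose = carries_compose[OF this, of 1 "of_bool x" "of_bool y" "of_bool z"]
  have "s' \<in> reach (zip a (zip b (z # g))) s \<longleftrightarrow>
      (\<exists>s''. s'' \<in> reach (zip a' (zip b' g)) s \<and> s' \<in> set (succs (x, y, z) s''))"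
    unfolding ab zip_Cons_Cons reach.simps by blast
  also have "\<dots> \<longleftrightarrow> (\<exists>s''. carries (length g) (bval a') (bval b') (bval g) s s'' \<and>
      carries 1 (of_bool x) (of_bool y) (of_bool z) s'' s')"
    using Cons.IH[of a' b'] Cons.prems unfolding ab carries_1 by simp
  also have "\<dots> \<longleftrightarrow> carries (length (z # g)) (bval a) (bval b) (bval (z # g)) s s'"
    using compose Cons.prems unfolding ab bval_Cons by simp
  finally show ?case .
qed

section \<open>Rotation, and the vanishing of the probability in terms of carries\<close>

lemma rotl_split:
  assumes "z1 < 2 ^ r" "z0 < 2 ^ m"
  shows "rotl (r + m) r (z1 * 2 ^ m + z0) = z0 * 2 ^ r + z1"
proof -
  have "(z1 * 2 ^ m + z0) * 2 ^ r mod 2 ^ (r + m) = ((z1 * 2 ^ m + z0) mod 2 ^ m) * 2 ^ r"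
    by (simp add: power_add mult.commute[of "2 ^ r"] mod_mult_mult2)
  then show ?thesis using assms by (simp add: rotl_def)
qed

lemma rotl_split_less:
  fixes z0 z1 :: nat
  assumes "z1 < 2 ^ r" "z0 < 2 ^ m"
  shows "z0 * 2 ^ r + z1 < 2 ^ (r + m)"
  using assms ex_less_split[of m r "\<lambda>z. z = z0 * 2 ^ r + z1"] by (auto simp: add.commute)

lemma adpXR_eq_0_iff:
  assumes "length a = m" "length b = m" "length g = m"
    and "length a' = r" "length b' = r" "length g' = r"
  shows "adpXR (r + m) r (bval (a' @ a)) (bval (b' @ b)) (bval (g @ g')) = 0 \<longleftrightarrow>
    \<not> (\<exists>p q c p' q' c'. (p, q, c') \<in> reach (zip a (zip b g)) (False, False, c) \<and>
         (p', q', c) \<in> reach (zip a' (zip b' g')) (p, q, False))"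
proof -
  let ?N = "2 ^ (r + m) :: nat"
  let ?A = "bval (a' @ a)" and ?B = "bval (b' @ b)" and ?G = "bval (g @ g')"
  let ?f = "\<lambda>x y. rotl (r + m) r (xor x y)"
  let ?S = "{(x, y). x < ?N \<and> y < ?N \<and> ?f ((x + ?A) mod ?N) ((y + ?B) mod ?N) = (?f x y + ?G) mod ?N}"
  have AB: "?A = bval a' * 2 ^ m + bval a" "?B = bval b' * 2 ^ m + bval b"
      "?G = bval g * 2 ^ r + bval g'"
    using assms by (simp_all add: bval_append)
  have bounds: "bval a < 2 ^ m" "bval b < 2 ^ m" "bval g < 2 ^ m"
      "bval a' < 2 ^ r" "bval b' < 2 ^ r" "bval g' < 2 ^ r"
    using bval_less assms by metis+
  have "?A < ?N" "?B < ?N" "?G < ?N"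
    using bval_less assms by (metis add.commute length_append)+
  have rotl_less: "rotl (r + m) r z < ?N" if "z < ?N" for z
  proof -
    have "\<exists>z1<2 ^ r. \<exists>z0<2 ^ m. z = z1 * 2 ^ m + z0"
      using that ex_less_split[of r m "\<lambda>x. z = x"] by blast
    then show ?thesis using rotl_split rotl_split_less by auto
  qed
  have "finite ?S" by (rule finite_subset[of _ "{..<?N} \<times> {..<?N}"]) auto
  then have "adpXR (r + m) r ?A ?B ?G = 0 \<longleftrightarrow> ?S = {}"
    by (simp add: adpXR_def adp_def)
  also have "\<dots> \<longleftrightarrow> \<not> (\<exists>x<?N. \<exists>y<?N. \<exists>u<?N. \<exists>v<?N. (\<exists>p'. x + ?A = u + ?N * of_bool p') \<and>
      (\<exists>q'. y + ?B = v + ?N * of_bool q') \<and> (\<exists>c'. ?f x y + ?G = ?f u v + ?N * of_bool c'))"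
    (is "_ \<longleftrightarrow> \<not> ?E")
  proof -
    have "(\<exists>u<?N. \<exists>v<?N. (\<exists>p'. x + ?A = u + ?N * of_bool p') \<and>
        (\<exists>q'. y + ?B = v + ?N * of_bool q') \<and> (\<exists>c'. ?f x y + ?G = ?f u v + ?N * of_bool c')) \<longleftrightarrow>
      ?f ((x + ?A) mod ?N) ((y + ?B) mod ?N) = (?f x y + ?G) mod ?N" (is "?l \<longleftrightarrow> ?r")
      if xy: "x < ?N" "y < ?N" for x y
    proof -
      have "?l \<longleftrightarrow> (\<exists>u<?N. \<exists>v<?N. (x + ?A) mod ?N = u \<and> (y + ?B) mod ?N = v \<and>
          (?f x y + ?G) mod ?N = ?f u v)"
        using mod_eq_iff_carry[OF xy(1) \<open>?A < ?N\<close>] mod_eq_iff_carry[OF xy(2) \<open>?B < ?N\<close>]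
          mod_eq_iff_carry[OF rotl_less[OF xor_less_power2[OF xy]] \<open>?G < ?N\<close>]
          rotl_less[OF xor_less_power2]
        by (intro ex_cong1 conj_cong refl) simp_all
      then show ?thesis by auto
    qed
    then have "?E \<longleftrightarrow> (\<exists>x<?N. \<exists>y<?N. ?f ((x + ?A) mod ?N) ((y + ?B) mod ?N) = (?f x y + ?G) mod ?N)"
      by (intro ex_cong1 conj_cong refl)
    then show ?thesis by blast
  qed
  also have "?E \<longleftrightarrow> (\<exists>p q c p' q' c'. carries m (bval a) (bval b) (bval g) (False, False, c) (p, q, c') \<and>
      carries r (bval a') (bval b') (bval g') (p, q, False) (p', q', c))"
  proof -
    \<comment> \<open>The tuple \<open>s\<close> bundles all six carries, so that
      \<open>ex_bound_distrib\<close> can separate the halves.\<close>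
    have split: "(\<exists>p'. x1 * 2 ^ m + x0 + ?A = u1 * 2 ^ m + u0 + ?N * of_bool p') \<and>
        (\<exists>q'. y1 * 2 ^ m + y0 + ?B = v1 * 2 ^ m + v0 + ?N * of_bool q') \<and>
        (\<exists>c'. ?f (x1 * 2 ^ m + x0) (y1 * 2 ^ m + y0) + ?G
            = ?f (u1 * 2 ^ m + u0) (v1 * 2 ^ m + v0) + ?N * of_bool c') \<longleftrightarrow>
      (\<exists>s. (case s of (p, q, c, p', q', c') \<Rightarrow>
          add_xor m (bval a) (bval b) (bval g) (False, False, c) (p, q, c')) x0 y0 u0 v0 \<and>
        (case s of (p, q, c, p', q', c') \<Rightarrow>
          add_xor r (bval a') (bval b') (bval g') (p, q, False) (p', q', c)) x1 y1 u1 v1)"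
      if "x1 < 2 ^ r" "x0 < 2 ^ m" "y1 < 2 ^ r" "y0 < 2 ^ m"
        "u1 < 2 ^ r" "u0 < 2 ^ m" "v1 < 2 ^ r" "v0 < 2 ^ m" for x0 x1 y0 y1 u0 u1 v0 v1
    proof -
      have less: "xor x0 y0 < 2 ^ m" "xor u0 v0 < 2 ^ m" "xor x1 y1 < 2 ^ r" "xor u1 v1 < 2 ^ r"
        using that by (simp_all add: xor_less_power2)
      have "(x1 * 2 ^ m + x0 + ?A = u1 * 2 ^ m + u0 + ?N * of_bool p') \<longleftrightarrow>
          (\<exists>p. x0 + bval a + of_bool False = u0 + 2 ^ m * of_bool p \<and>
            x1 + bval a' + of_bool p = u1 + 2 ^ r * of_bool p')" for p'
        using add_carry_split[of x0 "2 ^ m" "bval a" u0 x1 "bval a'" False u1 "2 ^ r" p'] that bounds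
        by (simp only: AB power_add of_bool_eq add_0_right)
      moreover have "(y1 * 2 ^ m + y0 + ?B = v1 * 2 ^ m + v0 + ?N * of_bool q') \<longleftrightarrow>
          (\<exists>q. y0 + bval b + of_bool False = v0 + 2 ^ m * of_bool q \<and>
            y1 + bval b' + of_bool q = v1 + 2 ^ r * of_bool q')" for q'
        using add_carry_split[of y0 "2 ^ m" "bval b" v0 y1 "bval b'" False v1 "2 ^ r" q'] that bounds
        by (simp only: AB power_add of_bool_eq add_0_right)
      \<comment> \<open>After the rotation the high half supplies the low digits: the base is
        \<open>2 ^ r\<close>, and \<open>c\<close> runs from the high half to the low one.\<close>
      moreover have "(?f (x1 * 2 ^ m + x0) (y1 * 2 ^ m + y0) + ?G
            = ?f (u1 * 2 ^ m + u0) (v1 * 2 ^ m + v0) + ?N * of_bool c') \<longleftrightarrow>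
          (\<exists>c. xor x1 y1 + bval g' + of_bool False = xor u1 v1 + 2 ^ r * of_bool c \<and>
            xor x0 y0 + bval g + of_bool c = xor u0 v0 + 2 ^ m * of_bool c')" for c'
        using add_carry_split[of "xor x1 y1" "2 ^ r" "bval g'" "xor u1 v1" "xor x0 y0" "bval g" False
            "xor u0 v0" "2 ^ m" c'] that bounds less
        by (simp only: AB power_add of_bool_eq add_0_right xor_split rotl_split mult.commute)
      ultimately show ?thesis
        unfolding add_xor_def split_paired_Ex prod.case ex_conj_distrib6 by (simp only:)
    qed
    have "?E \<longleftrightarrow> (\<exists>x1<2 ^ r. \<exists>x0<2 ^ m. \<exists>y1<2 ^ r. \<exists>y0<2 ^ m. \<exists>u1<2 ^ r. \<exists>u0<2 ^ m. \<exists>v1<2 ^ r. \<exists>v0<2 ^ m.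
      \<exists>s. (case s of (p, q, c, p', q', c') \<Rightarrow>
          add_xor m (bval a) (bval b) (bval g) (False, False, c) (p, q, c')) x0 y0 u0 v0 \<and>
        (case s of (p, q, c, p', q', c') \<Rightarrow>
          add_xor r (bval a') (bval b') (bval g') (p, q, False) (p', q', c)) x1 y1 u1 v1)"
      unfolding ex_less_split by (intro ex_cong1 conj_cong refl split)
    then show ?thesis unfolding carries_def ex_bound_distrib unfolding split_paired_Ex prod.case .
  qed
  finally show ?thesis
    using assms by (simp add: reach_iff_carries)
qed

section \<open>Deciding pattern membership by determinisation\<close>

definition all_bits :: "bits list" where
  "all_bits = [(False, False, False), (False, False, True), (False, True, False), (False, True, True),
     (True, False, False), (True, False, True), (True, True, False), (True, True, True)]"

lemma set_all_bits: "t \<in> set all_bits"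
  by (cases t) (auto simp: all_bits_def)

text \<open>Universal predecessors. The automaton reads the head last, so pulling \<open>V\<close>
  back consumes words from the front, as derivatives do. Filtering \<open>all_bits\<close> makes
  equal sets equal lists.\<close>

definition pre :: "bits \<Rightarrow> bits list \<Rightarrow> bits list" where
  "pre t V = filter (\<lambda>s. list_all (\<lambda>s'. s' \<in> set V) (succs t s)) all_bits"

lemma reach_Cons_subset_iff: "reach (t # w) s \<subseteq> set V \<longleftrightarrow> reach w s \<subseteq> set (pre t V)"
  by (auto simp: pre_def list_all_iff set_all_bits simp del: succs.simps)

text \<open>Antimirov's partial derivatives; a star may be kept or skipped, hence a list.\<close>

fun deriv :: "nat \<Rightarrow> pat \<Rightarrow> pat list" where
  "deriv c [] = []"
| "deriv c (One S # p) = (if c \<in> S then [p] else [])"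
| "deriv c (Star S # p) = (if c \<in> S then [Star S # p] else []) @ deriv c p"

lemma matches_Star_Cons:
  "matches (Star S # p) (c # w) \<longleftrightarrow> matches p (c # w) \<or> c \<in> S \<and> matches (Star S # p) w"
proof -
  have "(\<exists>k\<le>Suc n. Q k) \<longleftrightarrow> Q 0 \<or> (\<exists>k\<le>n. Q (Suc k))" for n Q
    by (metis Suc_le_mono le0 not0_implies_Suc)
  then show ?thesis by auto
qed

lemma matches_Cons: "matches p (c # w) \<longleftrightarrow> (\<exists>q \<in> set (deriv c p). matches q w)"
proof (induction c p rule: deriv.induct)
  case (3 c S p)
  then show ?case unfolding matches_Star_Cons by (auto simp del: matches.simps(3))
qed simp_all

definition derivs :: "nat \<Rightarrow> pat list \<Rightarrow> pat list" where
  "derivs c ps = remdups (concat (map (deriv c) ps))"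

lemma matches_derivs: "(\<exists>p \<in> set ps. matches p (c # w)) \<longleftrightarrow> (\<exists>p \<in> set (derivs c ps). matches p w)"
  by (auto simp: derivs_def matches_Cons)

fun nullable :: "pat \<Rightarrow> bool" where
  "nullable [] = True"
| "nullable (One S # p) = False"
| "nullable (Star S # p) = nullable p"

lemma nullable_iff: "nullable p \<longleftrightarrow> matches p []"
  by (induction p rule: nullable.induct) simp_all

type_synonym conf = "bits list \<times> pat list"

definition conf_step :: "conf \<Rightarrow> bits \<Rightarrow> conf" where
  "conf_step q t = (pre t (fst q), derivs (enc t) (snd q))"

definition agree :: "bits list \<Rightarrow> conf \<Rightarrow> bool" where
  "agree F q \<longleftrightarrow> list_all (\<lambda>s. s \<in> set (fst q)) F = list_ex nullable (snd q)"

text \<open>Nested conditionals rather than a conjunction: the simplifier evaluates conditionals lazily, so the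
  costly comparison of pattern lists is only made when the state sets coincide.\<close>

fun visited :: "conf \<Rightarrow> conf list \<Rightarrow> bool" where
  "visited q [] = False"
| "visited q (q' # Q) =
     (if fst q = fst q' then if snd q = snd q' then True else visited q Q else visited q Q)"

lemma visited_iff: "visited q Q \<longleftrightarrow> q \<in> set Q"
  by (induction Q) (auto simp: prod_eq_iff)

text \<open>Worklist search with fuel \<open>n\<close> and visited set \<open>Q\<close>.\<close>

fun explore :: "nat \<Rightarrow> bits list \<Rightarrow> conf list \<Rightarrow> conf list \<Rightarrow> bool" where
  "explore n F Q [] = True"
| "explore 0 F Q (q # todo) = False"
| "explore (Suc n) F Q (q # todo) =
     (if visited q Q then explore n F Q todo
      else if agree F q then explore n F (q # Q) (map (conf_step q) all_bits @ todo)
      else False)"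

text \<open>Configurations already in \<open>Q\<close> are not examined again, so closure is claimed
  only for the others; with \<open>Q\<close> empty, \<open>R\<close> is fully closed.\<close>

lemma explore_closed:
  assumes "explore n F Q todo"
  shows "\<exists>R. set Q \<union> set todo \<subseteq> R \<and>
    (\<forall>q \<in> R. q \<in> set Q \<or> agree F q \<and> (\<forall>t. conf_step q t \<in> R))"
  using assms
proof (induction n F Q todo rule: explore.induct)
  case (1 n F Q)
  then show ?case by (intro exI[of _ "set Q"]) auto
next
  case (3 n F Q q todo)
  show ?case
  proof (cases "visited q Q")
    case True
    with 3 obtain R where "set Q \<union> set todo \<subseteq> R"
      "\<forall>q \<in> R. q \<in> set Q \<or> agree F q \<and> (\<forall>t. conf_step q t \<in> R)" by auto
    then show ?thesis using True by (intro exI[of _ R]) (auto simp: visited_iff)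
  next
    case False
    with 3 have agree: "agree F q" by (simp split: if_splits)
    with False 3 obtain R where R: "set (q # Q) \<union> set (map (conf_step q) all_bits @ todo) \<subseteq> R"
      "\<forall>q' \<in> R. q' \<in> set (q # Q) \<or> agree F q' \<and> (\<forall>t. conf_step q' t \<in> R)" by fastforce
    then have "conf_step q t \<in> R" for t using set_all_bits[of t] by auto
    then show ?thesis using R agree by (intro exI[of _ R]) auto
  qed
qed simp

text \<open>The closed set is an invariant of the lockstep run: \<open>agree\<close> settles the
  empty word, and each symbol stays inside the set.\<close>

lemma explore_correct:
  assumes "explore n F [] [(V, ps)]"
  shows "(\<forall>s \<in> set F. reach w s \<subseteq> set V) \<longleftrightarrow> (\<exists>p \<in> set ps. matches p (map enc w))"
proof -
  obtain R where "set [] \<union> set [(V, ps)] \<subseteq> R"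
    and R: "\<forall>q \<in> R. q \<in> set [] \<or> agree F q \<and> (\<forall>t. conf_step q t \<in> R)"
    using explore_closed[OF assms] by (elim exE conjE)
  then have "(V, ps) \<in> R" by simp
  have "(\<forall>s \<in> set F. reach w s \<subseteq> set (fst q)) \<longleftrightarrow> (\<exists>p \<in> set (snd q). matches p (map enc w))"
    if "q \<in> R" for q
    using that
  proof (induction w arbitrary: q)
    case Nil
    then have "agree F q" using R by simp
    then show ?case by (simp add: agree_def list_all_iff list_ex_iff nullable_iff)
  next
    case (Cons t w)
    then have "conf_step q t \<in> R" using R by (cases t) simp
    from Cons.IH[OF this] show ?case
      unfolding reach_Cons_subset_iff list.map matches_derivs conf_step_def fst_conv snd_conv .
  qed
  from this[OF \<open>(V, ps) \<in> R\<close>] show ?thesis by simp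
qed

section \<open>Carry triples realised by the two halves\<close>

text \<open>\<open>common X\<close> is the set \<open>A\<^sub>X\<close>.\<close>

fun common :: "nat \<Rightarrow> bits \<Rightarrow> bool" where
  "common X (p, q, r) = [p \<and> q, p \<and> \<not> q, \<not> p \<and> q, \<not> p \<and> \<not> q, p \<noteq> q, True, \<not> r] ! (X - 1)"

text \<open>\<open>p'\<close> and \<open>q'\<close> are lost modulo \<open>2 ^ n\<close>. The third
  carry starts clear because the output addition begins in this half.\<close>

definition high_set :: "bits list \<Rightarrow> bits set" where
  "high_set w = {(p, q, r). \<exists>p' q'. (p', q', r) \<in> reach w (p, q, False)}"

definition low_set :: "bits list \<Rightarrow> bits set" where
  "low_set w = {(p, q, r). \<exists>r'. (p, q, r') \<in> reach w (False, False, r)}"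

section \<open>Equivalences between automata and patterns, decided by evaluation\<close>

lemma list_all_explore_correct:
  assumes "list_all (\<lambda>x. explore n (F x) [] [(V x, ps x)]) xs" and "x \<in> set xs"
  shows "(\<forall>s \<in> set (F x). reach w s \<subseteq> set (V x)) \<longleftrightarrow> (\<exists>p \<in> set (ps x). matches p (map enc w))"
proof (rule explore_correct)
  show "explore n (F x) [] [(V x, ps x)]" using assms by (simp add: list_all_iff)
qed

abbreviation low_starts :: "bits list" where
  "low_starts \<equiv> [(False, False, False), (False, False, True)]"

abbreviation high_starts :: "bits list" where
  "high_starts \<equiv> [(False, False, False), (False, True, False), (True, False, False), (True, True, False)]"

text \<open>For these \<open>X\<close>, \<open>common X\<close> ignores the third carry, so
  inclusion means that no run begins at a start outside it: the target set is empty.\<close>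

lemma check_high:
  "list_all (\<lambda>X. explore 200 (filter (\<lambda>s. \<not> common X s) high_starts) [] [([], [M X])]) [1, 2, 3, 4, 5, 6]"
  by code_simp

lemma check_high_7:
  "explore 200 high_starts [] [(filter (common 7) all_bits, [M 7])]"
  by code_simp

lemma check_low:
  "list_all (\<lambda>X. explore 500 low_starts [] [(filter (\<lambda>s. \<not> common X s) all_bits, P X @ P 6)])
     [1, 2, 3, 4, 5, 6]"
  by code_simp

text \<open>\<open>common 7\<close> restricts only the carry entering the low half, so a single
  start matters, and it must have no run.\<close>

lemma check_low_7: "explore 200 [(False, False, False)] [] [([], P 7 @ P 6)]"
  by code_simp

text \<open>Since \<open>P 6\<close> describes an empty low set, every nonempty one contains a
  diagonal pair.\<close>

lemma check_low_diagonal: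
  "explore 200 low_starts [] [(filter (\<lambda>s. fst s \<noteq> fst (snd s)) all_bits, P 6)]"
  by code_simp

lemma check_high_nonempty: "explore 200 high_starts [] [([], [])]"
  by code_simp

text \<open>The words for which no run starts in \<open>s\<close>: the automaton stays in \<open>s\<close> while it reads the symbol
  \<open>s\<close>, and blocks on a symbol of the other parity.\<close>

definition dead_pat :: "bits \<Rightarrow> pat" where
  "dead_pat s = [Star cDot, One (if parity s then cE else cD), Star {enc s}]"

lemma check_dead: "list_all (\<lambda>s. explore 200 [s] [] [([], [dead_pat s])]) high_starts"
  by code_simp

lemma check_dead_False:
  "list_all (\<lambda>s. explore 200 [s] [] [(filter (\<lambda>s. snd (snd s)) all_bits, [dead_pat s])]) high_starts"
  by code_simp

text \<open>Unlike the previous check this has an exception: under \<open>M 7\<close> the outgoing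
  third carry is never set.\<close>

lemma check_dead_True:
  "list_all (\<lambda>s. explore 200 [s] [] [(filter (\<lambda>s. \<not> snd (snd s)) all_bits, [dead_pat s, M 7])]) high_starts"
  by code_simp

lemma set_high_starts: "set high_starts = {s. \<not> snd (snd s)}"
  by auto

lemma ball_high_starts: "(\<forall>s \<in> set high_starts. Q s) \<longleftrightarrow> (\<forall>p q. Q (p, q, False))"
  by (simp add: all_bool_eq) blast

lemma ball_low_starts: "(\<forall>s \<in> set low_starts. Q s) \<longleftrightarrow> (\<forall>r. Q (False, False, r))"
  by (simp add: all_bool_eq) blast

lemma set_filter_all_bits: "set (filter Q all_bits) = Collect Q"
  by (simp add: set_all_bits)

lemma set_low_starts: "set low_starts = {s. \<not> fst s \<and> \<not> fst (snd s)}"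
  by auto

lemma common_third:
  assumes "X \<in> set [1, 2, 3, 4, 5, 6]"
  shows "\<exists>c. \<forall>p q r. common X (p, q, r) = c p q"
proof (intro exI allI)
  show "common X (p, q, r) = common X (p, q, False)" for p q r using assms by auto
qed

lemma atLeastAtMost_1_7: "X \<in> {1..7::nat} \<longleftrightarrow> X \<in> set [1, 2, 3, 4, 5, 6] \<or> X = 7"
  by auto

lemma high_set_subset_iff:
  assumes "X \<in> {1..7}"
  shows "high_set w \<subseteq> Collect (common X) \<longleftrightarrow> matches (M X) (map enc w)"
proof (cases "X = 7")
  case True
  have "high_set w \<subseteq> Collect (common 7) \<longleftrightarrow> (\<forall>p q. reach w (p, q, False) \<subseteq> Collect (common 7))"
    by (fastforce simp: high_set_def)
  also have "\<dots> \<longleftrightarrow> (\<forall>s \<in> set high_starts. reach w s \<subseteq> set (filter (common 7) all_bits))"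
    by (simp only: ball_high_starts set_filter_all_bits)
  finally show ?thesis
    using explore_correct[OF check_high_7, of w] True by simp
next
  case False
  with assms have X: "X \<in> set [1, 2, 3, 4, 5, 6]" unfolding atLeastAtMost_1_7 by blast
  obtain c where c: "\<forall>p q r. common X (p, q, r) = c p q" using common_third[OF X] ..
  have "high_set w \<subseteq> Collect (common X) \<longleftrightarrow>
      (\<forall>p q. \<not> common X (p, q, False) \<longrightarrow> reach w (p, q, False) = {})"
    by (fastforce simp: high_set_def c simp del: common.simps)
  also have "\<dots> \<longleftrightarrow> (\<forall>s \<in> set high_starts. \<not> common X s \<longrightarrow> reach w s \<subseteq> set [])"
    by (simp only: ball_high_starts list.set(1) subset_empty)
  also have "\<dots> \<longleftrightarrow> (\<forall>s \<in> set (filter (\<lambda>s. \<not> common X s) high_starts). reach w s \<subseteq> set [])"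
    unfolding set_filter by blast
  also have "\<dots> \<longleftrightarrow> (\<exists>p \<in> set [M X]. matches p (map enc w))"
    by (rule list_all_explore_correct[OF check_high X])
  finally show ?thesis by simp
qed

lemma low_set_disjoint_iff:
  assumes "X \<in> {1..7}"
  shows "low_set w \<inter> Collect (common X) = {} \<longleftrightarrow> (\<exists>p \<in> set (P X @ P 6). matches p (map enc w))"
proof (cases "X = 7")
  case True
  have "low_set w \<inter> Collect (common 7) = {} \<longleftrightarrow> reach w (False, False, False) = {}"
    by (fastforce simp: low_set_def)
  then show ?thesis
    using explore_correct[OF check_low_7, of w] True by simp
next
  case False
  with assms have X: "X \<in> set [1, 2, 3, 4, 5, 6]" unfolding atLeastAtMost_1_7 by blast
  obtain c where c: "\<forall>p q r. common X (p, q, r) = c p q" using common_third[OF X] ..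
  have "low_set w \<inter> Collect (common X) = {} \<longleftrightarrow>
      (\<forall>r. \<forall>s' \<in> reach w (False, False, r). \<not> common X s')"
    by (fastforce simp: low_set_def c simp del: common.simps)
  also have "\<dots> \<longleftrightarrow> (\<forall>s \<in> set low_starts. reach w s \<subseteq> set (filter (\<lambda>s. \<not> common X s) all_bits))"
    unfolding ball_low_starts set_filter_all_bits by blast
  also have "\<dots> \<longleftrightarrow> (\<exists>p \<in> set (P X @ P 6). matches p (map enc w))"
    by (rule list_all_explore_correct[OF check_low X])
  finally show ?thesis .
qed

section \<open>Shapes of the two carry sets, and when they are disjoint\<close>

lemma low_set_diagonal:
  assumes "low_set w \<noteq> {}"
  obtains k r where "(k, k, r) \<in> low_set w"
proof -
  have "\<not> (\<exists>p \<in> set (P 6). matches p (map enc w))"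
    using low_set_disjoint_iff[of 6 w] assms by auto
  then have "\<not> (\<forall>s \<in> set low_starts. reach w s \<subseteq> set (filter (\<lambda>s. fst s \<noteq> fst (snd s)) all_bits))"
    using explore_correct[OF check_low_diagonal] by blast
  then obtain s u where "s \<in> set low_starts" "u \<in> reach w s" "fst u = fst (snd u)"
    unfolding set_filter_all_bits by blast
  then have "(fst u, fst u, snd (snd s)) \<in> low_set w"
    unfolding set_low_starts low_set_def by (cases s; cases u) auto
  then show ?thesis by (rule that)
qed

text \<open>A step needs equal parities and the last symbol is read first. It therefore fixes
  \<open>r\<close> in the low half and \<open>p \<noteq> q\<close> in the high half.\<close>

lemma reach_parity:
  assumes "s' \<in> reach w s" "w \<noteq> []"
  shows "parity (last w) = parity s"
  using assms
proof (induction w arbitrary: s')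
  case (Cons t w)
  have "parity t = parity u" if "s' \<in> set (succs t u)" for u
    using that by (cases t; cases u) (simp split: if_splits)
  with Cons show ?case by auto
qed simp

lemma low_set_third:
  assumes "(p, q, r) \<in> low_set w" "(p', q', r') \<in> low_set w" "w \<noteq> []"
  shows "r = r'"
  using assms reach_parity[of _ w "(False, False, r)"] reach_parity[of _ w "(False, False, r')"]
  by (fastforce simp: low_set_def)

lemma high_set_parity:
  assumes "(p, q, r) \<in> high_set w" "(p', q', r') \<in> high_set w" "w \<noteq> []"
  shows "(p \<noteq> q) = (p' \<noteq> q')"
  using assms reach_parity[of _ w "(p, q, False)"] reach_parity[of _ w "(p', q', False)"]
  by (fastforce simp: high_set_def)

lemma high_set_nonempty: "high_set w \<noteq> {}"
proof -
  have "\<not> (\<forall>s \<in> set high_starts. reach w s \<subseteq> set [])"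
    unfolding explore_correct[OF check_high_nonempty] by simp
  then obtain p q where "reach w (p, q, False) \<noteq> {}"
    unfolding ball_high_starts by auto
  then obtain p' q' r where "(p', q', r) \<in> reach w (p, q, False)" by auto
  then have "(p, q, r) \<in> high_set w" by (auto simp: high_set_def)
  then show ?thesis by blast
qed

lemma high_set_third:
  assumes "(p, q, c) \<in> high_set w" "\<not> high_set w \<subseteq> Collect (common 7)"
  shows "(p, q, r) \<in> high_set w"
proof -
  let ?s = "(p, q, False)"
  have s: "?s \<in> set high_starts" unfolding set_high_starts by simp
  have "reach w ?s \<noteq> {}" using assms(1) by (auto simp: high_set_def)
  then have dead: "\<not> matches (dead_pat ?s) (map enc w)"
    using list_all_explore_correct[OF check_dead s, of w] by simp
  have "\<not> matches (M 7) (map enc w)" using assms(2) high_set_subset_iff[of 7 w] by simp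
  with dead have "\<not> reach w ?s \<subseteq> {s. snd (snd s)}" "\<not> reach w ?s \<subseteq> {s. \<not> snd (snd s)}"
    using list_all_explore_correct[OF check_dead_False s, of w]
      list_all_explore_correct[OF check_dead_True s, of w] by (simp_all add: set_filter_all_bits del: set_filter)
  then show ?thesis by (cases r) (auto simp: high_set_def)
qed

text \<open>For the hard direction with \<open>L\<close> nonempty: the third carry has a single value \<open>r\<close> on \<open>L\<close>.  Unless
  \<open>X = 7\<close> works, \<open>(p, q, r)\<close> lies in \<open>H\<close> whenever some \<open>(p, q, c)\<close> does, so only the pairs \<open>(p, q)\<close>
  matter, and by parity those of \<open>H\<close> are at most two complementary ones; both being diagonal is
  impossible because \<open>L\<close> contains a diagonal pair.\<close>

lemma high_low_disjoint_iff:
  assumes "v \<noteq> []" "w \<noteq> []"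
  shows "high_set v \<inter> low_set w = {} \<longleftrightarrow>
    (\<exists>X \<in> {1..7}. high_set v \<subseteq> Collect (common X) \<and> low_set w \<inter> Collect (common X) = {})"
proof
  assume disj: "high_set v \<inter> low_set w = {}"
  show "\<exists>X \<in> {1..7}. high_set v \<subseteq> Collect (common X) \<and> low_set w \<inter> Collect (common X) = {}"
  proof (cases "low_set w = {}")
    case True
    then show ?thesis by (intro bexI[of _ 6]) auto
  next
    case False
    then obtain k r where k: "(k, k, r) \<in> low_set w" by (rule low_set_diagonal)
    have low: "r' = r" if "(p, q, r') \<in> low_set w" for p q r'
      using low_set_third[OF that k \<open>w \<noteq> []\<close>] .
    show ?thesis
    proof (cases "high_set v \<subseteq> Collect (common 7) \<and> r")
      case True
      \<comment> \<open>All of the low set has third carry \<open>r\<close>, which is set, so it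
        misses \<open>common 7\<close>.\<close>
      then show ?thesis using low by (intro bexI[of _ 7]) fastforce+
    next
      case False
      have lift: "(p, q, r) \<in> high_set v" if "(p, q, c) \<in> high_set v" for p q c
      proof (cases "high_set v \<subseteq> Collect (common 7)")
        case True
        then have "\<not> c" "\<not> r" using that False by auto
        then show ?thesis using that by simp
      qed (rule high_set_third[OF that])
      obtain p q c where pqc: "(p, q, c) \<in> high_set v" using high_set_nonempty[of v] by auto
      have parity: "(p' \<noteq> q') = (p \<noteq> q)" if "(p', q', c') \<in> high_set v" for p' q' c'
        using high_set_parity[OF that pqc \<open>v \<noteq> []\<close>] .
      have apart: "(p', q', c') \<notin> low_set w" if "(p', q', c'') \<in> high_set v" for p' q' c' c''
        using lift[OF that] low disj by blast
      show ?thesis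
      proof (cases "\<exists>d. (\<not> p, \<not> q, d) \<in> high_set v")
        case True
        then obtain d where d: "(\<not> p, \<not> q, d) \<in> high_set v" ..
        have "p \<noteq> q"
        proof
          assume "p = q"
          \<comment> \<open>The two diagonal pairs are then both excluded, but \<open>(k, k)\<close>
            is one of them.\<close>
          then show False using apart[OF pqc] apart[OF d] k by (cases "k = p") auto
        qed
        have "(p', q', c') \<notin> low_set w" if "p' \<noteq> q'" for p' q' c'
        proof (cases "p' = p")
          case True
          then have "q' = q" using that \<open>p \<noteq> q\<close> by auto
          then show ?thesis using apart[OF pqc] True by simp
        next
          case False
          then have "p' = (\<not> p)" "q' = (\<not> q)" using that \<open>p \<noteq> q\<close> by auto
          then show ?thesis using apart[OF d] by simp
        qed
        then show ?thesis using parity \<open>p \<noteq> q\<close> by (intro bexI[of _ 5]) auto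
      next
        case False
        then have single: "p' = p \<and> q' = q" if "(p', q', c') \<in> high_set v" for p' q' c'
          using parity[OF that] that by (cases "p' = p") auto
        define X :: nat where "X = (if p then if q then 1 else 2 else if q then 3 else 4)"
        have X: "common X (p', q', c') \<longleftrightarrow> p' = p \<and> q' = q" for p' q' c'
          by (auto simp: X_def)
        have "high_set v \<subseteq> Collect (common X)" using single by (auto simp: X simp del: common.simps)
        moreover have "low_set w \<inter> Collect (common X) = {}"
          using apart[OF pqc] by (auto simp: X simp del: common.simps)
        moreover have "X \<in> {1..7}" by (simp add: X_def)
        ultimately show ?thesis by blast
      qed
    qed
  qed
qed blast

theorem theorem9:
  fixes n r :: nat and a b g a' b' g' :: "bool list"
  assumes "n \<ge> 2" and "1 \<le> r" and "r \<le> n - 1"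
    and "length a = n - r" and "length b = n - r" and "length g = n - r"
    and "length a' = r" and "length b' = r" and "length g' = r"
  shows "adpXR n r (bval (a' @ a)) (bval (b' @ b)) (bval (g @ g')) = 0 \<longleftrightarrow>
         (\<exists>X \<in> {1..7}. matches (M X) (omega a' b' g') \<and>
                       (\<exists>p \<in> set (P X). matches p (omega a b g)))"
proof -
  let ?v = "zip a' (zip b' g')" and ?w = "zip a (zip b g)"
  have n: "r + (n - r) = n" using assms by simp
  have "adpXR n r (bval (a' @ a)) (bval (b' @ b)) (bval (g @ g')) = 0 \<longleftrightarrow>
      \<not> (\<exists>p q c p' q' c'. (p, q, c') \<in> reach ?w (False, False, c) \<and> (p', q', c) \<in> reach ?v (p, q, False))"
    by (rule adpXR_eq_0_iff[of a "n - r" b g a' r b' g', unfolded n, OF assms(4-9)])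
  also have "\<dots> \<longleftrightarrow> high_set ?v \<inter> low_set ?w = {}"
    unfolding high_set_def low_set_def by blast
  also have "\<dots> \<longleftrightarrow>
      (\<exists>X \<in> {1..7}. high_set ?v \<subseteq> Collect (common X) \<and> low_set ?w \<inter> Collect (common X) = {})"
  proof (rule high_low_disjoint_iff)
    have "length ?v = r" "length ?w = n - r" using assms by simp_all
    then show "?v \<noteq> []" "?w \<noteq> []" using assms by auto
  qed
  also have "\<dots> \<longleftrightarrow> (\<exists>X \<in> {1..7}. matches (M X) (map enc ?v) \<and>
      (\<exists>p \<in> set (P X @ P 6). matches p (map enc ?w)))"
    by (intro bex_cong refl) (simp only: high_set_subset_iff low_set_disjoint_iff)
  also have "\<dots> \<longleftrightarrow> (\<exists>X \<in> {1..7}. matches (M X) (map enc ?v) \<and>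
      (\<exists>p \<in> set (P X). matches p (map enc ?w)))"
  proof -
    \<comment> \<open>\<open>M 6\<close> accepts every word, so a match in \<open>P 6\<close> is
      already witnessed by \<open>X = 6\<close>.\<close>
    have "matches (M 6) (map enc ?v)" using high_set_subset_iff[of 6 ?v] by auto
    moreover have "(6::nat) \<in> {1..7}" by simp
    ultimately show ?thesis unfolding set_append by blast
  qed
  finally show ?thesis by (simp only: omega_eq_map_enc)
qed

end
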